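(* Let $R$ be an s-unital ring. (i) If $R$ is properly purely infinite, then it is purely infinite. (ii) If the matrix ring $M_2(R)$ is purely infinite, then $R$ is properly purely infinite.
   Context: Rings are associative and not necessarily unital. A ring $R$ is s-unital if for each $x\in R$ there exist $u,v\in R$ with $ux=xv=x$. For $a\in R$, $RaR$ denotes the set of finite sums $\sum_i r_ias_i$ with $r_i,s_i\in R$. A ring $R$ is purely infinite if (i) no quotient of $R$ is a division ring, and (ii) whenever $a\in R$ and $b\in RaR$, there exist $x,y\in R$ with $b=xay$. An element $a\in R$ is properly infinite if $a\neq 0$ and there exist $\alpha_1,\alpha_2,\beta_1,\beta_2\in R$ with $\alpha_i a\beta_j=\delta_{ij}a$ for all $i,j\in\{1,2\}$. A ring is properly purely infinite if every nonzero element of it is properly infinite. *)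

theory Defs
  imports "HOL-Algebra.QuotRing"
begin

text \<open>
  The type class \<^class>\<open>ring\<close> describes associative rings without any assumption about a unit,
  so a ring is a type of this class, passed to the predicates below as \<open>TYPE('a)\<close>.
\<close>

definition s_unital :: "'a::ring itself \<Rightarrow> bool"
  where "s_unital _ \<longleftrightarrow> (\<forall>x::'a. \<exists>u v. u * x = x \<and> x * v = x)"

definition two_sided_ideal :: "'a::ring set \<Rightarrow> bool"
  where "two_sided_ideal I \<longleftrightarrow>
    0 \<in> I \<and> (\<forall>x\<in>I. \<forall>y\<in>I. x - y \<in> I) \<and> (\<forall>r. \<forall>x\<in>I. r * x \<in> I \<and> x * r \<in> I)"

text \<open>
  Records of \<open>HOL-Algebra\<close> always have a field for a unit. In the record of a possibly
  non-unital ring that field holds an arbitrary element \<open>u\<close>. The quotient by \<open>I\<close> then has the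
  coset of \<open>u\<close> in that field. Every coset arises in this way, so the quotient is a division ring
  iff its record is a division ring for some \<open>u\<close>.
\<close>

definition ring_record :: "'a::ring \<Rightarrow> 'a ring"
  where "ring_record u = \<lparr>carrier = UNIV, mult = (*), one = u, zero = 0, add = (+)\<rparr>"

text \<open>The equation on units also excludes the zero ring, whose only element is a unit.\<close>

definition is_division_ring :: "'b ring \<Rightarrow> bool"
  where "is_division_ring D \<longleftrightarrow> Ring.ring D \<and> Units D = carrier D - {\<zero>\<^bsub>D\<^esub>}"

definition quotient_is_division_ring :: "'a::ring set \<Rightarrow> bool"
  where "quotient_is_division_ring I \<longleftrightarrow> (\<exists>u. is_division_ring (ring_record u Quot I))"

text \<open>The set \<open>RaR\<close>.\<close>

definition two_sided_multiples :: "'a::ring \<Rightarrow> 'a set"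
  where "two_sided_multiples a = {\<Sum>i<n. r i * a * s i | (n::nat) r s. True}"

definition purely_infinite :: "'a::ring itself \<Rightarrow> bool"
  where "purely_infinite _ \<longleftrightarrow>
    (\<forall>I :: 'a set. two_sided_ideal I \<longrightarrow> \<not> quotient_is_division_ring I) \<and>
    (\<forall>a b :: 'a. b \<in> two_sided_multiples a \<longrightarrow> (\<exists>x y. b = x * a * y))"

definition properly_infinite :: "'a::ring \<Rightarrow> bool"
  where "properly_infinite a \<longleftrightarrow> a \<noteq> 0 \<and>
    (\<exists>\<alpha> \<beta> :: nat \<Rightarrow> 'a. \<forall>i\<in>{1,2}. \<forall>j\<in>{1,2}. \<alpha> i * a * \<beta> j = (if i = j then a else 0))"

definition properly_purely_infinite :: "'a::ring itself \<Rightarrow> bool"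
  where "properly_purely_infinite _ \<longleftrightarrow> (\<forall>a::'a. a \<noteq> 0 \<longrightarrow> properly_infinite a)"

text \<open>
  The ring of 2 by 2 matrices; \<open>Mat2 a b c d\<close> has rows \<open>(a, b)\<close> and \<open>(c, d)\<close>. The matrix product
  of \<open>HOL-Analysis\<close> requires entries from a unital semiring.
\<close>

datatype 'a mat2 = Mat2 (e11: 'a) (e12: 'a) (e21: 'a) (e22: 'a)

instantiation mat2 :: (ring) ring
begin

definition "0 = Mat2 0 0 0 0"
definition "A + B = Mat2 (e11 A + e11 B) (e12 A + e12 B) (e21 A + e21 B) (e22 A + e22 B)"
definition "- A = Mat2 (- e11 A) (- e12 A) (- e21 A) (- e22 A)"
definition "A - B = Mat2 (e11 A - e11 B) (e12 A - e12 B) (e21 A - e21 B) (e22 A - e22 B)"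
definition "A * B = Mat2
  (e11 A * e11 B + e12 A * e21 B) (e11 A * e12 B + e12 A * e22 B)
  (e21 A * e11 B + e22 A * e21 B) (e21 A * e12 B + e22 A * e22 B)"

instance
  by standard
    (auto simp: zero_mat2_def plus_mat2_def uminus_mat2_def minus_mat2_def times_mat2_def
      algebra_simps)

end

end

theory Submission
  imports Defs
begin

text \<open>
  If \<open>\<alpha>\<^sub>i a \<beta>\<^sub>j = \<delta>\<^sub>i\<^sub>j a\<close>, then
  \<open>x a y + r a s = (x \<alpha>\<^sub>1 + r \<alpha>\<^sub>2) a (\<beta>\<^sub>1 y + \<beta>\<^sub>2 s)\<close>: the off-diagonal relations
  kill the mixed terms. So a properly infinite \<open>a\<close> absorbs the terms of an element of \<open>RaR\<close>
  one by one into a single product (\<open>properly_infinite_collect\<close>). The same off-diagonal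
  relations exclude quotient division rings: modulo such an ideal \<open>I\<close>, an element
  \<open>a \<notin> I\<close> would satisfy \<open>\<alpha>\<^sub>1 a \<beta>\<^sub>2 = 0\<close> with all three factors nonzero, although
  the nonzero elements of a division ring are closed under multiplication
  (\<open>quotient_division_ring_prime\<close>).

  Conversely, the four relations say exactly that \<open>diag(a, a) = X diag(a, 0) Y\<close> in \<open>M\<^sub>2(R)\<close>,
  where \<open>\<alpha>\<close> is the first column of \<open>X\<close> and \<open>\<beta>\<close> the first row of \<open>Y\<close>. Over an s-unital ring
  \<open>diag(a, a)\<close> is a sum of two multiples of \<open>diag(a, 0)\<close>, so such \<open>X\<close> and \<open>Y\<close> exist when
  \<open>M\<^sub>2(R)\<close> is purely infinite.
\<close>

lemma two_sided_ideal_add: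
  assumes "two_sided_ideal I" "x \<in> I" "y \<in> I"
  shows "x + y \<in> I"
proof -
  have "0 - y \<in> I"
    using assms unfolding two_sided_ideal_def by blast
  then have "x - (0 - y) \<in> I"
    using assms unfolding two_sided_ideal_def by blast
  then show ?thesis by simp
qed

lemma coset_ring_record: "I +>\<^bsub>ring_record u\<^esub> x = {y. y - x \<in> I}"
  by (auto simp: a_r_coset_def' ring_record_def)

lemma coset_ring_record_eq_ideal_iff:
  assumes "two_sided_ideal I"
  shows "I +>\<^bsub>ring_record u\<^esub> x = I \<longleftrightarrow> x \<in> I"
proof
  assume "I +>\<^bsub>ring_record u\<^esub> x = I"
  moreover have "x \<in> I +>\<^bsub>ring_record u\<^esub> x"
    using assms by (simp add: coset_ring_record two_sided_ideal_def)
  ultimately show "x \<in> I" by simp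
next
  assume "x \<in> I"
  then show "I +>\<^bsub>ring_record u\<^esub> x = I"
    using assms two_sided_ideal_add[OF assms, of _ x]
    by (fastforce simp: coset_ring_record two_sided_ideal_def)
qed

text \<open>
  Since \<open>u\<close> need not act as a unit, the record \<open>ring_record u\<close> need not satisfy the axioms of a
  ring with one; the product of cosets is therefore computed with representatives.
\<close>

lemma rcoset_mult_ring_record:
  assumes "two_sided_ideal I"
  shows "rcoset_mult (ring_record u) I
      (I +>\<^bsub>ring_record u\<^esub> x) (I +>\<^bsub>ring_record u\<^esub> y) = I +>\<^bsub>ring_record u\<^esub> (x * y)"
    (is "?L = ?R")
proof -
  have mem: "z - p * q \<in> I \<longleftrightarrow> z - x * y \<in> I" if "p - x \<in> I" "q - y \<in> I" for p q z
  proof -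
    have "(p - x) * q \<in> I" "x * (q - y) \<in> I"
      using assms that by (auto simp: two_sided_ideal_def)
    then have "(p - x) * q + x * (q - y) \<in> I"
      using two_sided_ideal_add[OF assms] by blast
    then have d: "p * q - x * y \<in> I"
      by (simp add: algebra_simps)
    show ?thesis
    proof
      assume "z - p * q \<in> I"
      then have "(z - p * q) + (p * q - x * y) \<in> I"
        using d two_sided_ideal_add[OF assms] by blast
      then show "z - x * y \<in> I" by simp
    next
      assume "z - x * y \<in> I"
      then have "(z - x * y) - (p * q - x * y) \<in> I"
        using d assms unfolding two_sided_ideal_def by blast
      then show "z - p * q \<in> I" by simp
    qed
  qed
  have m: "p \<otimes>\<^bsub>ring_record u\<^esub> q = p * q" for p q
    by (simp add: ring_record_def)
  have "x - x \<in> I" "y - y \<in> I"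
    using assms by (auto simp: two_sided_ideal_def)
  then show ?thesis
    unfolding rcoset_mult_def coset_ring_record m using mem by blast
qed

lemma quotient_division_ring_prime:
  assumes I: "two_sided_ideal I" and "is_division_ring (ring_record u Quot I)"
    and "x \<notin> I" "y \<notin> I"
  shows "x * y \<notin> I"
proof -
  let ?D = "ring_record u Quot I"
  interpret D: Ring.ring ?D
    using assms unfolding is_division_ring_def by simp
  have units: "Units ?D = carrier ?D - {I}"
    using assms unfolding is_division_ring_def by (simp add: FactRing_def)
  have "I +>\<^bsub>ring_record u\<^esub> z \<in> Units ?D" if "z \<notin> I" for z
    using that coset_ring_record_eq_ideal_iff[OF I] unfolding units
    by (auto simp: FactRing_def A_RCOSETS_def' ring_record_def)
  then have "(I +>\<^bsub>ring_record u\<^esub> x) \<otimes>\<^bsub>?D\<^esub> (I +>\<^bsub>ring_record u\<^esub> y) \<in> Units ?D"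
    using assms by (intro D.Units_m_closed)
  then have "I +>\<^bsub>ring_record u\<^esub> (x * y) \<noteq> I"
    unfolding units using rcoset_mult_ring_record[OF I] by (simp add: FactRing_def)
  then show ?thesis
    using coset_ring_record_eq_ideal_iff[OF I] by simp
qed

lemma quotient_division_ring_one_notin:
  assumes I: "two_sided_ideal I" and "is_division_ring (ring_record u Quot I)"
  shows "u \<notin> I"
proof -
  let ?D = "ring_record u Quot I"
  interpret D: Ring.ring ?D
    using assms unfolding is_division_ring_def by simp
  have "\<one>\<^bsub>?D\<^esub> \<noteq> \<zero>\<^bsub>?D\<^esub>"
    using assms D.Units_one_closed unfolding is_division_ring_def by blast
  then have "I +>\<^bsub>ring_record u\<^esub> u \<noteq> I"
    by (simp add: FactRing_def) (simp add: ring_record_def)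
  then show ?thesis
    using coset_ring_record_eq_ideal_iff[OF I] by simp
qed

lemma properly_infiniteE:
  assumes "properly_infinite a"
  obtains \<alpha>1 \<alpha>2 \<beta>1 \<beta>2 where "\<alpha>1 * a * \<beta>1 = a" "\<alpha>1 * a * \<beta>2 = 0"
    "\<alpha>2 * a * \<beta>1 = 0" "\<alpha>2 * a * \<beta>2 = a"
  using assms unfolding properly_infinite_def by auto

text \<open>
  If \<open>\<alpha>\<^sub>1 a\<close> or \<open>\<beta>\<^sub>2\<close> were in \<open>I\<close>, then so would be \<open>a = \<alpha>\<^sub>1 a \<beta>\<^sub>1 = \<alpha>\<^sub>2 a \<beta>\<^sub>2\<close>.
  Thus \<open>\<alpha>\<^sub>1 a \<beta>\<^sub>2 = 0\<close> makes two nonzero elements of the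
  quotient, the images of \<open>\<alpha>\<^sub>1 a\<close> and \<open>\<beta>\<^sub>2\<close>, multiply to zero.
\<close>

lemma properly_infinite_no_division_quotient:
  assumes I: "two_sided_ideal I" and "a \<notin> I" and "properly_infinite a"
  shows "\<not> quotient_is_division_ring I"
proof
  assume "quotient_is_division_ring I"
  then obtain u where u: "is_division_ring (ring_record u Quot I)"
    unfolding quotient_is_division_ring_def by blast
  obtain \<alpha>1 \<alpha>2 \<beta>1 \<beta>2 where eqs: "\<alpha>1 * a * \<beta>1 = a" "\<alpha>1 * a * \<beta>2 = 0" "\<alpha>2 * a * \<beta>2 = a"
    using assms(3) by (rule properly_infiniteE)
  have "\<alpha>1 * a \<notin> I" "\<beta>2 \<notin> I"
    using I \<open>a \<notin> I\<close> eqs unfolding two_sided_ideal_def by metis+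
  then have "\<alpha>1 * a * \<beta>2 \<notin> I"
    by (rule quotient_division_ring_prime[OF I u])
  then show False
    using I eqs by (simp add: two_sided_ideal_def)
qed

lemma properly_infinite_collect:
  assumes "properly_infinite a"
  shows "\<exists>x y. (\<Sum>i<(n::nat). r i * a * s i) = x * a * y"
proof (induction n)
  case 0
  have "(\<Sum>i<(0::nat). r i * a * s i) = 0 * a * 0" by simp
  then show ?case by blast
next
  case (Suc n)
  then obtain x y where xy: "(\<Sum>i<n. r i * a * s i) = x * a * y" by blast
  obtain \<alpha>1 \<alpha>2 \<beta>1 \<beta>2 where eqs: "\<alpha>1 * a * \<beta>1 = a" "\<alpha>1 * a * \<beta>2 = 0"
      "\<alpha>2 * a * \<beta>1 = 0" "\<alpha>2 * a * \<beta>2 = a"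
    using assms by (rule properly_infiniteE)
  have "(x * \<alpha>1 + r n * \<alpha>2) * a * (\<beta>1 * y + \<beta>2 * s n)
      = x * (\<alpha>1 * a * \<beta>1) * y + x * (\<alpha>1 * a * \<beta>2) * s n
        + r n * (\<alpha>2 * a * \<beta>1) * y + r n * (\<alpha>2 * a * \<beta>2) * s n"
    by (simp add: algebra_simps)
  also have "\<dots> = x * a * y + r n * a * s n"
    by (simp add: eqs)
  finally have "(\<Sum>i<Suc n. r i * a * s i) = (x * \<alpha>1 + r n * \<alpha>2) * a * (\<beta>1 * y + \<beta>2 * s n)"
    using xy by simp
  then show ?case by blast
qed

theorem properly_purely_infinite_imp_purely_infinite:
  assumes "properly_purely_infinite TYPE('a::ring)"
  shows "purely_infinite TYPE('a)"
  unfolding purely_infinite_def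
proof (intro conjI allI impI)
  fix I :: "'a set"
  assume I: "two_sided_ideal I"
  show "\<not> quotient_is_division_ring I"
  proof
    assume "quotient_is_division_ring I"
    then obtain u where "u \<notin> I"
      using quotient_division_ring_one_notin[OF I] unfolding quotient_is_division_ring_def by blast
    moreover have "properly_infinite u"
      using assms I \<open>u \<notin> I\<close> unfolding properly_purely_infinite_def two_sided_ideal_def by metis
    ultimately show False
      using properly_infinite_no_division_quotient[OF I] \<open>quotient_is_division_ring I\<close> by blast
  qed
next
  fix a b :: 'a
  assume "b \<in> two_sided_multiples a"
  then obtain n :: nat and r s where b: "b = (\<Sum>i<n. r i * a * s i)"
    unfolding two_sided_multiples_def by blast
  show "\<exists>x y. b = x * a * y"
  proof (cases "a = 0")
    case True
    then show ?thesis using b by simp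
  next
    case False
    then show ?thesis
      using assms properly_infinite_collect b unfolding properly_purely_infinite_def by blast
  qed
qed

text \<open>
  With \<open>u a v = a\<close>, the elements \<open>u\<close> and \<open>v\<close> can stand in for the unit in the matrix units that
  move the corner entry \<open>a\<close> to the second diagonal position.
\<close>

lemma diag_in_two_sided_multiples:
  fixes a :: "'a::ring"
  assumes "s_unital TYPE('a)"
  shows "Mat2 a 0 0 a \<in> two_sided_multiples (Mat2 a 0 0 0)"
proof -
  obtain u v where uv: "u * a = a" "a * v = a"
    using assms unfolding s_unital_def by blast
  define r where "r i = (if i = 0 then Mat2 u 0 0 0 else Mat2 0 0 u 0)" for i :: nat
  define s where "s i = (if i = 0 then Mat2 v 0 0 0 else Mat2 0 v 0 0)" for i :: nat
  have "Mat2 a 0 0 a = (\<Sum>i<2. r i * Mat2 a 0 0 0 * s i)"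
    by (simp add: numeral_2_eq_2 r_def s_def times_mat2_def plus_mat2_def zero_mat2_def uv)
  then show ?thesis
    unfolding two_sided_multiples_def by blast
qed

theorem purely_infinite_mat2_imp_properly_purely_infinite:
  assumes "s_unital TYPE('a::ring)" and "purely_infinite TYPE('a mat2)"
  shows "properly_purely_infinite TYPE('a)"
  unfolding properly_purely_infinite_def
proof (intro allI impI)
  fix a :: 'a
  assume "a \<noteq> 0"
  obtain X Y where XY: "Mat2 a 0 0 a = X * Mat2 a 0 0 0 * Y"
    using assms(2) diag_in_two_sided_multiples[OF assms(1)] unfolding purely_infinite_def by blast
  define \<alpha> where "\<alpha> i = (if i = 1 then e11 X else e21 X)" for i :: nat
  define \<beta> where "\<beta> j = (if j = 1 then e11 Y else e12 Y)" for j :: nat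
  have "\<forall>i\<in>{1,2}. \<forall>j\<in>{1,2}. \<alpha> i * a * \<beta> j = (if i = j then a else 0)"
    using XY by (simp add: times_mat2_def \<alpha>_def \<beta>_def)
  then show "properly_infinite a"
    unfolding properly_infinite_def using \<open>a \<noteq> 0\<close> by blast
qed

theorem lemma3p4:
  assumes "s_unital TYPE('a::ring)"
  shows "(properly_purely_infinite TYPE('a) \<longrightarrow> purely_infinite TYPE('a)) \<and>
         (purely_infinite TYPE('a mat2) \<longrightarrow> properly_purely_infinite TYPE('a))"
  using assms properly_purely_infinite_imp_purely_infinite
    purely_infinite_mat2_imp_properly_purely_infinite by blast

end
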